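(* Let $K$ be a partition of $X$ parametrized by $(T,\mathcal A,\phi)$, let $d\in\mathcal D(X,\mathcal O)$ and let $g$ be a weight function. Then $d$ is adapted to $g$ and $g$ is tight if and only if $d\in\mathcal D_A(X,\mathcal O)$ and $g_d$ is bi-Lipschitz equivalent to $g$, i.e. there are $c_1,c_2>0$ with $c_1g(w)\le g_d(w)\le c_2g(w)$ for all $w\in T$.
   Context: Setting. $T$ is a countably infinite set, $\mathcal A:T\times T\to\{0,1\}$ is symmetric and vanishes on the diagonal, the graph on $T$ with edges $\{(w,v):\mathcal A(w,v)=1\}$ is a locally finite tree, and $\phi\in T$ is a fixed root. For $w\in T$: $|w|$ is the tree distance from $\phi$ to $w$; $(T)_m=\{w:|w|=m\}$; $\pi(w)$ is the neighbour of $w$ on the geodesic from $\phi$ to $w$ ($\pi(\phi)=\phi$); $S(w)$ is the set of neighbours of $w$ other than $\pi(w)$. $\Sigma$ is the set of infinite geodesic rays $\omega=([\omega]_0=\phi,[\omega]_1,\ldots)$ of the tree starting at $\phi$. $(X,\mathcal O)$ is a compact metrizable topological space with no isolated point. A partition $K$ of $X$ parametrized by $(T,\mathcal A,\phi)$ assigns to each $w\in T$ a nonempty compact set $K_w\subseteq X$ such that $K_\phi=X$, $K_w=\bigcup_{v\in S(w)}K_v$ for all $w$, and $\bigcap_{m\ge0}K_{[\omega]_m}$ is a single point for every $\omega\in\Sigma$. Weight functions. A weight function is $g:T\to(0,1]$ with $g(\phi)=1$, $g(\pi(w))\ge g(w)$ for all $w$, and $\lim_{m\to\infty}\sup_{w\in(T)_m}g(w)=0$.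 For $s\in(0,1)$, $\Lambda^g_s=\{w\in T: g(\pi(w))>s\ge g(w)\}$; for $s\ge1$, $\Lambda^g_s=\{\phi\}$. For an integer $M\ge0$, $x\in X$, $s>0$, $U^g_M(x,s)$ is the set of $y\in X$ for which there are $w(1),\ldots,w(M+1)\in\Lambda^g_s$ with $x\in K_{w(1)}$, $y\in K_{w(M+1)}$ and $K_{w(i)}\cap K_{w(i+1)}\ne\emptyset$ for $1\le i\le M$. $\delta^g_M(x,y)=\inf\{s\in(0,1]:y\in U^g_M(x,s)\}$. $g$ is tight if for any integer $M\ge0$ there exists $c>0$ such that $\sup_{x,y\in K_w}\delta^g_M(x,y)\ge c\,g(w)$ for any $w\in T$. Metrics. $\mathcal D(X,\mathcal O)$ is the set of metrics $d$ on $X$ inducing $\mathcal O$ with $\operatorname{diam}(X,d)=1$; $B_d(x,r)=\{y:d(x,y)<r\}$. For $d\in\mathcal D(X,\mathcal O)$, $g_d:T\to(0,1]$, $g_d(w)=\operatorname{diam}(K_w,d)$. $d$ is $M$-adapted to a weight function $g$ if there are $\alpha_1,\alpha_2>0$ with $U^g_M(x,\alpha_1r)\subseteq B_d(x,r)\subseteq U^g_M(x,\alpha_2r)$ for all $x\in X$, $r>0$; $d$ is adapted to $g$ if it is $M$-adapted to $g$ for some integer $M\ge0$. $d$ is called adapted if $g_d$ is a weight function (i.e. all $\operatorname{diam}(K_w,d)>0$) and $d$ is adapted to $g_d$. $\mathcal D_A(X,\mathcal O)$ is the set of adapted $d\in\mathcal D(X,\mathcal O)$. *)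

theory Defs
  imports "HOL-Analysis.Analysis"
begin

section \<open>Locally finite rooted trees\<close>

text \<open>
  A graph is a vertex set \<open>T\<close> with a symmetric adjacency function \<open>A\<close> with values in
  \<open>{0, 1}\<close>. Functions on \<open>T\<close> are total functions on the ambient type; their values off \<open>T\<close>
  are never used.
\<close>

definition simple_path :: "'t set \<Rightarrow> ('t \<Rightarrow> 't \<Rightarrow> nat) \<Rightarrow> 't \<Rightarrow> 't \<Rightarrow> 't list \<Rightarrow> bool" where
  "simple_path T A w v p \<longleftrightarrow>
     p \<noteq> [] \<and> hd p = w \<and> last p = v \<and> set p \<subseteq> T \<and>
     successively (\<lambda>a b. A a b = 1) p \<and> distinct p"

definition is_tree :: "'t set \<Rightarrow> ('t \<Rightarrow> 't \<Rightarrow> nat) \<Rightarrow> bool" where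
  "is_tree T A \<longleftrightarrow> (\<forall>w\<in>T. \<forall>v\<in>T. \<exists>!p. simple_path T A w v p)"

text \<open>In a tree the geodesic is the unique simple path, listed with both end points.\<close>

definition geodesic :: "'t set \<Rightarrow> ('t \<Rightarrow> 't \<Rightarrow> nat) \<Rightarrow> 't \<Rightarrow> 't \<Rightarrow> 't list" where
  "geodesic T A w v = (THE p. simple_path T A w v p)"

locale locally_finite_rooted_tree =
  fixes T :: "'t set" and A :: "'t \<Rightarrow> 't \<Rightarrow> nat" and \<phi> :: 't
  assumes countable_vertices: "countable T"
    and infinite_vertices: "infinite T"
    and adjacency_range: "\<And>w v. w \<in> T \<Longrightarrow> v \<in> T \<Longrightarrow> A w v \<in> {0, 1}"
    and adjacency_sym: "\<And>w v. w \<in> T \<Longrightarrow> v \<in> T \<Longrightarrow> A w v = A v w"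
    and adjacency_diag: "\<And>w. w \<in> T \<Longrightarrow> A w w = 0"
    and locally_finite: "\<And>w. w \<in> T \<Longrightarrow> finite {v \<in> T. A w v = 1}"
    and tree: "is_tree T A"
    and root_in: "\<phi> \<in> T"

definition height :: "'t set \<Rightarrow> ('t \<Rightarrow> 't \<Rightarrow> nat) \<Rightarrow> 't \<Rightarrow> 't \<Rightarrow> nat" where
  "height T A \<phi> w = length (geodesic T A \<phi> w) - 1"

definition level :: "'t set \<Rightarrow> ('t \<Rightarrow> 't \<Rightarrow> nat) \<Rightarrow> 't \<Rightarrow> nat \<Rightarrow> 't set" where
  "level T A \<phi> m = {w \<in> T. height T A \<phi> w = m}"

definition parent :: "'t set \<Rightarrow> ('t \<Rightarrow> 't \<Rightarrow> nat) \<Rightarrow> 't \<Rightarrow> 't \<Rightarrow> 't" where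
  "parent T A \<phi> w = (if w = \<phi> then \<phi> else last (butlast (geodesic T A \<phi> w)))"

definition children :: "'t set \<Rightarrow> ('t \<Rightarrow> 't \<Rightarrow> nat) \<Rightarrow> 't \<Rightarrow> 't \<Rightarrow> 't set" where
  "children T A \<phi> w = {v \<in> T. A w v = 1} - {parent T A \<phi> w}"

definition rays :: "'t set \<Rightarrow> ('t \<Rightarrow> 't \<Rightarrow> nat) \<Rightarrow> 't \<Rightarrow> (nat \<Rightarrow> 't) set" where
  "rays T A \<phi> =
     {\<omega>. \<omega> 0 = \<phi> \<and> range \<omega> \<subseteq> T \<and> (\<forall>n. geodesic T A \<phi> (\<omega> n) = map \<omega> [0..<Suc n])}"


section \<open>Partitions\<close>

locale parametrized_partition = locally_finite_rooted_tree T A \<phi>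
  for T :: "'t set" and A :: "'t \<Rightarrow> 't \<Rightarrow> nat" and \<phi> :: 't +
  fixes X :: "'a topology" and K :: "'t \<Rightarrow> 'a set"
  assumes compact_space: "compact_space X"
    and metrizable_space: "metrizable_space X"
    and no_isolated_point: "\<And>x. x \<in> topspace X \<Longrightarrow> \<not> openin X {x}"
    and cell_compact: "\<And>w. w \<in> T \<Longrightarrow> compactin X (K w)"
    and cell_nonempty: "\<And>w. w \<in> T \<Longrightarrow> K w \<noteq> {}"
    and cell_root: "K \<phi> = topspace X"
    and cell_children: "\<And>w. w \<in> T \<Longrightarrow> K w = (\<Union>v\<in>children T A \<phi> w. K v)"
    and cell_ray: "\<And>\<omega>. \<omega> \<in> rays T A \<phi> \<Longrightarrow> \<exists>x. (\<Inter>m. K (\<omega> m)) = {x}"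


section \<open>Weight functions\<close>

definition weight_function :: "'t set \<Rightarrow> ('t \<Rightarrow> 't \<Rightarrow> nat) \<Rightarrow> 't \<Rightarrow> ('t \<Rightarrow> real) \<Rightarrow> bool" where
  "weight_function T A \<phi> g \<longleftrightarrow>
     (\<forall>w\<in>T. 0 < g w \<and> g w \<le> 1) \<and>
     g \<phi> = 1 \<and>
     (\<forall>w\<in>T. g (parent T A \<phi> w) \<ge> g w) \<and>
     (\<lambda>m. SUP w\<in>level T A \<phi> m. g w) \<longlonglongrightarrow> 0"

text \<open>Only used for \<open>s > 0\<close>.\<close>

definition scale ::
  "'t set \<Rightarrow> ('t \<Rightarrow> 't \<Rightarrow> nat) \<Rightarrow> 't \<Rightarrow> ('t \<Rightarrow> real) \<Rightarrow> real \<Rightarrow> 't set" where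
  "scale T A \<phi> g s =
     (if s \<ge> 1 then {\<phi>} else {w \<in> T. g (parent T A \<phi> w) > s \<and> s \<ge> g w})"

definition chain_nbhd ::
  "'t set \<Rightarrow> ('t \<Rightarrow> 't \<Rightarrow> nat) \<Rightarrow> 't \<Rightarrow> 'a topology \<Rightarrow> ('t \<Rightarrow> 'a set) \<Rightarrow> ('t \<Rightarrow> real) \<Rightarrow>
   nat \<Rightarrow> 'a \<Rightarrow> real \<Rightarrow> 'a set" where
  "chain_nbhd T A \<phi> X K g M x s =
     {y \<in> topspace X. \<exists>w :: nat \<Rightarrow> 't.
        (\<forall>i\<in>{1..M + 1}. w i \<in> scale T A \<phi> g s) \<and>
        x \<in> K (w 1) \<and> y \<in> K (w (M + 1)) \<and>
        (\<forall>i\<in>{1..M}. K (w i) \<inter> K (w (i + 1)) \<noteq> {})}"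

definition chain_dist ::
  "'t set \<Rightarrow> ('t \<Rightarrow> 't \<Rightarrow> nat) \<Rightarrow> 't \<Rightarrow> 'a topology \<Rightarrow> ('t \<Rightarrow> 'a set) \<Rightarrow> ('t \<Rightarrow> real) \<Rightarrow>
   nat \<Rightarrow> 'a \<Rightarrow> 'a \<Rightarrow> real" where
  "chain_dist T A \<phi> X K g M x y =
     Inf {s. 0 < s \<and> s \<le> 1 \<and> y \<in> chain_nbhd T A \<phi> X K g M x s}"

definition tight ::
  "'t set \<Rightarrow> ('t \<Rightarrow> 't \<Rightarrow> nat) \<Rightarrow> 't \<Rightarrow> 'a topology \<Rightarrow> ('t \<Rightarrow> 'a set) \<Rightarrow> ('t \<Rightarrow> real) \<Rightarrow> bool" where
  "tight T A \<phi> X K g \<longleftrightarrow>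
     (\<forall>M. \<exists>c>0. \<forall>w\<in>T. (SUP (x, y)\<in>K w \<times> K w. chain_dist T A \<phi> X K g M x y) \<ge> c * g w)"


section \<open>Metrics\<close>

definition diam :: "('a \<Rightarrow> 'a \<Rightarrow> real) \<Rightarrow> 'a set \<Rightarrow> real" where
  "diam d S = (SUP (x, y)\<in>S \<times> S. d x y)"

text \<open>
  The predicate \<open>Metric_space\<close> also asks for symmetry and nonnegativity of \<open>d\<close> off the carrier;
  every metric on the carrier extends to the type in this way.
\<close>

definition normalized_metrics :: "'a topology \<Rightarrow> ('a \<Rightarrow> 'a \<Rightarrow> real) set" where
  "normalized_metrics X =
     {d. Metric_space (topspace X) d \<and> Metric_space.mtopology (topspace X) d = X \<and>
         diam d (topspace X) = 1}"

definition diam_weight :: "('t \<Rightarrow> 'a set) \<Rightarrow> ('a \<Rightarrow> 'a \<Rightarrow> real) \<Rightarrow> 't \<Rightarrow> real" where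
  "diam_weight K d w = diam d (K w)"

definition M_adapted_to ::
  "'t set \<Rightarrow> ('t \<Rightarrow> 't \<Rightarrow> nat) \<Rightarrow> 't \<Rightarrow> 'a topology \<Rightarrow> ('t \<Rightarrow> 'a set) \<Rightarrow>
   nat \<Rightarrow> ('a \<Rightarrow> 'a \<Rightarrow> real) \<Rightarrow> ('t \<Rightarrow> real) \<Rightarrow> bool" where
  "M_adapted_to T A \<phi> X K M d g \<longleftrightarrow>
     (\<exists>\<alpha>1>0. \<exists>\<alpha>2>0. \<forall>x\<in>topspace X. \<forall>r>0.
        chain_nbhd T A \<phi> X K g M x (\<alpha>1 * r) \<subseteq> Metric_space.mball (topspace X) d x r \<and>
        Metric_space.mball (topspace X) d x r \<subseteq> chain_nbhd T A \<phi> X K g M x (\<alpha>2 * r))"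

definition adapted_to ::
  "'t set \<Rightarrow> ('t \<Rightarrow> 't \<Rightarrow> nat) \<Rightarrow> 't \<Rightarrow> 'a topology \<Rightarrow> ('t \<Rightarrow> 'a set) \<Rightarrow>
   ('a \<Rightarrow> 'a \<Rightarrow> real) \<Rightarrow> ('t \<Rightarrow> real) \<Rightarrow> bool" where
  "adapted_to T A \<phi> X K d g \<longleftrightarrow> (\<exists>M. M_adapted_to T A \<phi> X K M d g)"

definition adapted_metrics ::
  "'t set \<Rightarrow> ('t \<Rightarrow> 't \<Rightarrow> nat) \<Rightarrow> 't \<Rightarrow> 'a topology \<Rightarrow> ('t \<Rightarrow> 'a set) \<Rightarrow>
   ('a \<Rightarrow> 'a \<Rightarrow> real) set" where
  "adapted_metrics T A \<phi> X K =
     {d \<in> normalized_metrics X.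
        weight_function T A \<phi> (diam_weight K d) \<and> adapted_to T A \<phi> X K d (diam_weight K d)}"

definition bi_Lipschitz_equivalent :: "'t set \<Rightarrow> ('t \<Rightarrow> real) \<Rightarrow> ('t \<Rightarrow> real) \<Rightarrow> bool" where
  "bi_Lipschitz_equivalent T h g \<longleftrightarrow>
     (\<exists>c1>0. \<exists>c2>0. \<forall>w\<in>T. c1 * g w \<le> h w \<and> h w \<le> c2 * g w)"

end

theory Submission
  imports Defs
begin

text \<open>
  A cell \<open>w\<close> with \<open>g w \<le> s\<close> lies inside a cell of the scale \<open>s\<close>, namely the one indexed by the
  highest ancestor of \<open>w\<close> whose weight is at most \<open>s\<close>. Hence \<open>h \<le> c g\<close> turns chains at the
  \<open>g\<close>-scale \<open>s\<close> into chains of the same length at the \<open>h\<close>-scale \<open>c s\<close>, and adaptedness passes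
  between bi-Lipschitz equivalent weights. For \<open>g\<^sub>d\<close> itself the inclusion of chain
  neighbourhoods in balls is the triangle inequality. Finally, if \<open>d\<close> is adapted to \<open>g\<close>, then
  the chain distance is comparable to \<open>d\<close>, so \<open>g\<^sub>d \<le> c g\<close> always holds and tightness supplies
  exactly the opposite bound.
\<close>

section \<open>Geodesics, parents and levels in the rooted tree\<close>

context locally_finite_rooted_tree
begin

lemma simple_path_geodesic:
  assumes "w \<in> T" "v \<in> T"
  shows "simple_path T A w v (geodesic T A w v)"
  using tree assms unfolding is_tree_def geodesic_def by (blast intro: theI')

lemma geodesic_eqI:
  assumes "w \<in> T" "v \<in> T" "simple_path T A w v p"
  shows "geodesic T A w v = p"
  using tree assms simple_path_geodesic[OF assms(1,2)] unfolding is_tree_def by blast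

text \<open>Dropping the last vertex of the geodesic to \<open>w\<close> leaves a simple path, and
  uniqueness of simple paths makes it the geodesic to the parent.\<close>

lemma geodesic_parent:
  assumes "w \<in> T" "w \<noteq> \<phi>"
  shows "parent T A \<phi> w \<in> T"
    and "A (parent T A \<phi> w) w = 1"
    and "geodesic T A \<phi> w = geodesic T A \<phi> (parent T A \<phi> w) @ [w]"
proof -
  define p where "p = geodesic T A \<phi> w"
  define q where "q = butlast p"
  have sp: "simple_path T A \<phi> w p"
    unfolding p_def by (rule simple_path_geodesic[OF root_in assms(1)])
  then have pq: "p = q @ [w]"
    unfolding q_def simple_path_def by (metis append_butlast_last_id)
  have "q \<noteq> []"
    using sp pq assms(2) unfolding simple_path_def by auto
  have par: "parent T A \<phi> w = last q"
    using assms(2) unfolding parent_def q_def p_def by simp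
  have last_edge: "A (last q) w = 1" and sub: "set q \<subseteq> T"
    using sp \<open>q \<noteq> []\<close> unfolding simple_path_def pq by (auto simp: successively_append_iff)
  then show inT: "parent T A \<phi> w \<in> T" and "A (parent T A \<phi> w) w = 1"
    using \<open>q \<noteq> []\<close> par by auto
  have "simple_path T A \<phi> (last q) q"
    using sp \<open>q \<noteq> []\<close> unfolding simple_path_def pq by (auto simp: successively_append_iff)
  then show "geodesic T A \<phi> w = geodesic T A \<phi> (parent T A \<phi> w) @ [w]"
    using geodesic_eqI[OF root_in inT] par pq p_def by simp
qed

lemma height_parent_less:
  assumes "w \<in> T" "w \<noteq> \<phi>"
  shows "height T A \<phi> (parent T A \<phi> w) < height T A \<phi> w"
proof -
  have "geodesic T A \<phi> (parent T A \<phi> w) \<noteq> []"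
    using simple_path_geodesic[OF root_in geodesic_parent(1)[OF assms]]
    by (simp add: simple_path_def)
  then show ?thesis
    by (simp add: height_def geodesic_parent(3)[OF assms])
qed

lemma parent_root [simp]: "parent T A \<phi> \<phi> = \<phi>"
  by (simp add: parent_def)

text \<open>\<open>children\<close> removes the parent of its argument, so the point is that the
  grandparent of \<open>w\<close> is not \<open>w\<close>: heights strictly decrease towards the
  root, and the root is its own parent.\<close>

lemma mem_children_parent:
  assumes "w \<in> T" "w \<noteq> \<phi>"
  shows "w \<in> children T A \<phi> (parent T A \<phi> w)"
proof -
  let ?u = "parent T A \<phi> w"
  have "parent T A \<phi> ?u \<noteq> w"
  proof (cases "?u = \<phi>")
    case True
    then show ?thesis using assms(2) by simp
  next
    case False
    then have "height T A \<phi> (parent T A \<phi> ?u) < height T A \<phi> w"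
      using height_parent_less[OF assms] height_parent_less[OF geodesic_parent(1)[OF assms]]
      by linarith
    then show ?thesis by auto
  qed
  then show ?thesis
    using assms geodesic_parent(2)[OF assms] unfolding children_def by auto
qed

text \<open>A squeeze that supplies the decay condition when \<open>diam_weight\<close> is shown to
  be a weight function.\<close>

lemma tendsto_SUP_level_dominated:
  assumes "weight_function T A \<phi> g"
    and "\<And>w. w \<in> T \<Longrightarrow> 0 \<le> h w" "\<And>w. w \<in> T \<Longrightarrow> h w \<le> c * g w" "0 < c"
  shows "(\<lambda>m. SUP w\<in>level T A \<phi> m. h w) \<longlonglongrightarrow> 0"
proof (rule tendsto_0_le)
  show "(\<lambda>m. SUP w\<in>level T A \<phi> m. g w) \<longlonglongrightarrow> 0"
    using assms(1) by (simp add: weight_function_def)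
  \<comment> \<open>The factor \<open>max 1 c\<close> instead of \<open>c\<close> also covers the
    formal case of an empty level, where it must be at least 1.\<close>
  have "\<bar>SUP w\<in>level T A \<phi> m. h w\<bar> \<le> \<bar>SUP w\<in>level T A \<phi> m. g w\<bar> * max 1 c" for m
  proof (cases "level T A \<phi> m = {}")
    case True
    \<comment> \<open>No level is empty, but both suprema are then the same unspecified number.\<close>
    have "\<bar>Sup {} :: real\<bar> * 1 \<le> \<bar>Sup {}\<bar> * max 1 c"
      by (rule mult_left_mono) auto
    with True show ?thesis by simp
  next
    case False
    then obtain u where u: "u \<in> level T A \<phi> m" by blast
    have sub: "level T A \<phi> m \<subseteq> T" by (auto simp: level_def)
    have g: "0 < g w" "g w \<le> 1" if "w \<in> level T A \<phi> m" for w
      using assms(1) sub that by (auto simp: weight_function_def)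
    have bdd_g: "bdd_above (g ` level T A \<phi> m)"
      using g(2) by (auto intro!: bdd_aboveI[where M = 1])
    have le: "h w \<le> c * (SUP w\<in>level T A \<phi> m. g w)" if "w \<in> level T A \<phi> m" for w
    proof -
      have "h w \<le> c * g w" using assms(3) sub that by blast
      also have "\<dots> \<le> c * (SUP w\<in>level T A \<phi> m. g w)"
        using assms(4) that by (intro mult_left_mono cSUP_upper bdd_g) auto
      finally show ?thesis .
    qed
    have "0 \<le> h u" using assms(2) sub u by blast
    also have "h u \<le> (SUP w\<in>level T A \<phi> m. h w)"
      using le u by (intro cSUP_upper bdd_aboveI2) auto
    finally have "\<bar>SUP w\<in>level T A \<phi> m. h w\<bar> = (SUP w\<in>level T A \<phi> m. h w)" by simp
    also have "\<dots> \<le> c * (SUP w\<in>level T A \<phi> m. g w)"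
      using False le by (rule cSUP_least)
    also have "\<dots> \<le> c * \<bar>SUP w\<in>level T A \<phi> m. g w\<bar>"
      using assms(4) by (intro mult_left_mono) auto
    also have "\<dots> \<le> max 1 c * \<bar>SUP w\<in>level T A \<phi> m. g w\<bar>"
      by (intro mult_right_mono) auto
    finally show ?thesis by (simp add: mult.commute)
  qed
  then show "\<forall>\<^sub>F m in sequentially. norm (SUP w\<in>level T A \<phi> m. h w)
      \<le> norm (SUP w\<in>level T A \<phi> m. g w) * max 1 c"
    by simp
qed

end

section \<open>Cells, scales and chain neighbourhoods\<close>

context parametrized_partition
begin

lemma cell_subset_parent:
  assumes "w \<in> T"
  shows "K w \<subseteq> K (parent T A \<phi> w)"
proof (cases "w = \<phi>")
  case False
  then show ?thesis
    using cell_children[OF geodesic_parent(1)[OF assms False]] mem_children_parent[OF assms False]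
    by blast
qed simp

lemma cell_subset: "w \<in> T \<Longrightarrow> K w \<subseteq> topspace X"
  using cell_compact compactin_subset_topspace by blast

text \<open>Climb from \<open>w\<close> towards the root until the parent has weight above
  \<open>s\<close>; cells only grow on the way.\<close>

lemma cell_in_scale:
  assumes "weight_function T A \<phi> g" "w \<in> T" "g w \<le> s"
  obtains u where "u \<in> scale T A \<phi> g s" "K w \<subseteq> K u"
proof -
  have "\<exists>u. u \<in> scale T A \<phi> g s \<and> K w \<subseteq> K u"
    using assms(2,3)
  proof (induction "height T A \<phi> w" arbitrary: w rule: less_induct)
    case less
    show ?case
    proof (cases "s \<ge> 1")
      case True
      then show ?thesis
        using cell_root cell_subset less.prems(1) by (auto simp: scale_def)
    next
      case False
      \<comment> \<open>The root has weight 1 > \<open>s\<close>, so the climb stops before reaching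
        it.\<close>
      then have "w \<noteq> \<phi>"
        using assms(1) less.prems by (auto simp: weight_function_def)
      show ?thesis
      proof (cases "g (parent T A \<phi> w) > s")
        case True
        then show ?thesis using False less.prems by (auto simp: scale_def)
      next
        case False
        then obtain u where "u \<in> scale T A \<phi> g s" "K (parent T A \<phi> w) \<subseteq> K u"
          using less.hyps[OF height_parent_less geodesic_parent(1)] \<open>w \<noteq> \<phi>\<close> less.prems(1)
          by fastforce
        then show ?thesis using cell_subset_parent less.prems(1) by blast
      qed
    qed
  qed
  then show ?thesis using that by blast
qed

lemma scaleD:
  assumes "weight_function T A \<phi> g" "w \<in> scale T A \<phi> g s"
  shows "w \<in> T" "g w \<le> s"
  using assms root_in by (auto simp: weight_function_def scale_def split: if_splits)

text \<open>Each cell of the chain is replaced by a larger one from the new scale, so links and end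
  points survive and the length stays the same.\<close>

lemma chain_nbhd_mono_weight:
  assumes "weight_function T A \<phi> g" "weight_function T A \<phi> h"
    and "\<And>w. w \<in> T \<Longrightarrow> h w \<le> c * g w" "0 < c"
  shows "chain_nbhd T A \<phi> X K g M x s \<subseteq> chain_nbhd T A \<phi> X K h M x (c * s)"
proof
  fix y assume "y \<in> chain_nbhd T A \<phi> X K g M x s"
  then obtain w where y: "y \<in> topspace X"
    and sc: "\<And>i. i \<in> {1..M + 1} \<Longrightarrow> w i \<in> scale T A \<phi> g s"
    and ends: "x \<in> K (w 1)" "y \<in> K (w (M + 1))"
    and link: "\<And>i. i \<in> {1..M} \<Longrightarrow> K (w i) \<inter> K (w (i + 1)) \<noteq> {}"
    unfolding chain_nbhd_def by blast
  have "\<exists>u. u \<in> scale T A \<phi> h (c * s) \<and> K (w i) \<subseteq> K u" if "i \<in> {1..M + 1}" for i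
  proof -
    note w = scaleD[OF assms(1) sc[OF that]]
    have "h (w i) \<le> c * g (w i)" by (rule assms(3)[OF w(1)])
    also have "\<dots> \<le> c * s" using w(2) assms(4) by simp
    finally show ?thesis using cell_in_scale[OF assms(2) w(1)] by blast
  qed
  then obtain u where u: "\<And>i. i \<in> {1..M + 1} \<Longrightarrow> u i \<in> scale T A \<phi> h (c * s)"
    "\<And>i. i \<in> {1..M + 1} \<Longrightarrow> K (w i) \<subseteq> K (u i)"
    by metis
  have "K (u i) \<inter> K (u (i + 1)) \<noteq> {}" if "i \<in> {1..M}" for i
    using link[OF that] u(2)[of i] u(2)[of "i + 1"] that by auto
  moreover have "x \<in> K (u 1)" "y \<in> K (u (M + 1))"
    using ends u(2)[of 1] u(2)[of "M + 1"] by auto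
  ultimately show "y \<in> chain_nbhd T A \<phi> X K h M x (c * s)"
    unfolding chain_nbhd_def using y u(1) by blast
qed

text \<open>The constant chain works for every \<open>M\<close>, its links being nonempty because
  they contain \<open>x\<close>.\<close>

lemma chain_nbhd_single_cell:
  assumes "w \<in> scale T A \<phi> g s" "w \<in> T" "x \<in> K w" "y \<in> K w"
  shows "y \<in> chain_nbhd T A \<phi> X K g M x s"
  unfolding chain_nbhd_def
  using assms cell_subset by (auto intro!: exI[of _ "\<lambda>_. w"])

text \<open>The root cell is all of the space; hence the infimum in \<open>chain_dist\<close> runs
  over a nonempty set and is at most 1.\<close>

lemma chain_nbhd_one:
  assumes "x \<in> topspace X" "y \<in> topspace X"
  shows "y \<in> chain_nbhd T A \<phi> X K g M x 1"
  by (rule chain_nbhd_single_cell[of \<phi>])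
    (use assms root_in cell_root in \<open>auto simp: scale_def\<close>)

lemma chain_dist_le:
  assumes "0 < s" "s \<le> 1" "y \<in> chain_nbhd T A \<phi> X K g M x s"
  shows "chain_dist T A \<phi> X K g M x y \<le> s"
  unfolding chain_dist_def using assms by (intro cInf_lower bdd_belowI[of _ 0]) auto

lemma le_chain_dist:
  assumes "x \<in> topspace X" "y \<in> topspace X"
    and "\<And>s. 0 < s \<Longrightarrow> s \<le> 1 \<Longrightarrow> y \<in> chain_nbhd T A \<phi> X K g M x s \<Longrightarrow> b \<le> s"
  shows "b \<le> chain_dist T A \<phi> X K g M x y"
  unfolding chain_dist_def
proof (rule cInf_greatest)
  show "{s. 0 < s \<and> s \<le> 1 \<and> y \<in> chain_nbhd T A \<phi> X K g M x s} \<noteq> {}"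
    using chain_nbhd_one[OF assms(1,2)] by (auto intro!: exI[of _ 1])
qed (use assms(3) in auto)

lemma bdd_above_chain_dist:
  assumes "w \<in> T"
  shows "bdd_above ((\<lambda>(x, y). chain_dist T A \<phi> X K g M x y) ` (K w \<times> K w))"
  using cell_subset[OF assms]
  by (auto intro!: bdd_aboveI2[where M = 1] chain_dist_le chain_nbhd_one)

end

section \<open>Diameters of cells and distances along chains\<close>

locale metric_partition = parametrized_partition T A \<phi> X K
  for T :: "'t set" and A :: "'t \<Rightarrow> 't \<Rightarrow> nat" and \<phi> :: 't
    and X :: "'a topology" and K :: "'t \<Rightarrow> 'a set" +
  fixes d :: "'a \<Rightarrow> 'a \<Rightarrow> real"
  assumes normalized: "d \<in> normalized_metrics X"
begin

sublocale Metric_space "topspace X" d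
  using normalized by (simp add: normalized_metrics_def)

text \<open>A real supremum is meaningful only over a nonempty set that is bounded above;
  compactness of the cell supplies the bound for \<open>diam\<close>.\<close>

lemma bdd_above_dist:
  assumes "w \<in> T"
  shows "bdd_above ((\<lambda>(x, y). d x y) ` (K w \<times> K w))"
proof -
  have "mtopology = X"
    using normalized by (simp add: normalized_metrics_def)
  then have "mbounded (K w)"
    using compactin_imp_mbounded cell_compact[OF assms] by metis
  then show ?thesis
    by (auto simp: mbounded_alt bdd_above_def)
qed

lemma dist_le_diam_weight:
  assumes "w \<in> T" "x \<in> K w" "y \<in> K w"
  shows "d x y \<le> diam_weight K d w"
  unfolding diam_weight_def diam_def
  using cSUP_upper[OF _ bdd_above_dist[OF assms(1)], of "(x, y)"] assms(2,3) by simp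

lemma diam_weight_le:
  assumes "w \<in> T" "\<And>x y. x \<in> K w \<Longrightarrow> y \<in> K w \<Longrightarrow> d x y \<le> b"
  shows "diam_weight K d w \<le> b"
  unfolding diam_weight_def diam_def
  using assms cell_nonempty by (intro cSUP_least) auto

lemma diam_weight_mono:
  assumes "w \<in> T" "v \<in> T" "K w \<subseteq> K v"
  shows "diam_weight K d w \<le> diam_weight K d v"
  using assms by (intro diam_weight_le dist_le_diam_weight) auto

lemma diam_weight_root: "diam_weight K d \<phi> = 1"
  using normalized by (simp add: diam_weight_def cell_root normalized_metrics_def)

text \<open>Positivity is a hypothesis because a partition may contain one-point cells. Domination
  by \<open>g\<close> gives the decay along levels.\<close>

lemma weight_function_diam_weight:
  assumes "weight_function T A \<phi> g" "0 < c"
    and "\<And>w. w \<in> T \<Longrightarrow> 0 < diam_weight K d w"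
    and "\<And>w. w \<in> T \<Longrightarrow> diam_weight K d w \<le> c * g w"
  shows "weight_function T A \<phi> (diam_weight K d)"
  unfolding weight_function_def
proof (intro conjI ballI)
  fix w assume w: "w \<in> T"
  show "0 < diam_weight K d w" by (rule assms(3)[OF w])
  show "diam_weight K d w \<le> 1"
    using diam_weight_mono[OF w root_in] cell_subset[OF w] by (simp add: cell_root diam_weight_root)
  have "parent T A \<phi> w \<in> T"
    using geodesic_parent(1)[OF w] root_in by (cases "w = \<phi>") auto
  then show "diam_weight K d w \<le> diam_weight K d (parent T A \<phi> w)"
    using w cell_subset_parent by (intro diam_weight_mono) auto
next
  show "diam_weight K d \<phi> = 1" by (rule diam_weight_root)
next
  show "(\<lambda>m. SUP w\<in>level T A \<phi> m. diam_weight K d w) \<longlonglongrightarrow> 0"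
    using assms by (intro tendsto_SUP_level_dominated[OF assms(1)]) (auto intro: less_imp_le)
qed

text \<open>The chain has \<open>M + 1\<close> cells, each of diameter at most \<open>c * s\<close>;
  the triangle inequality is applied through points of the successive intersections.\<close>

lemma dist_chain_le:
  assumes "weight_function T A \<phi> g" "0 < c"
    and "\<And>w. w \<in> T \<Longrightarrow> diam_weight K d w \<le> c * g w"
    and "y \<in> chain_nbhd T A \<phi> X K g M x s"
  shows "d x y \<le> real (M + 1) * (c * s)"
proof -
  obtain w where sc: "\<And>i. i \<in> {1..M + 1} \<Longrightarrow> w i \<in> scale T A \<phi> g s"
    and ends: "x \<in> K (w 1)" "y \<in> K (w (M + 1))"
    and link: "\<And>i. i \<in> {1..M} \<Longrightarrow> K (w i) \<inter> K (w (i + 1)) \<noteq> {}"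
    using assms(4) unfolding chain_nbhd_def by blast
  have inT: "w i \<in> T" if "i \<in> {1..M + 1}" for i
    using scaleD(1)[OF assms(1) sc[OF that]] .
  have step: "d p q \<le> c * s" if "i \<in> {1..M + 1}" "p \<in> K (w i)" "q \<in> K (w i)" for i p q
  proof -
    have "d p q \<le> c * g (w i)"
      using dist_le_diam_weight[OF inT that(2,3)] assms(3)[OF inT] that(1) by fastforce
    also have "\<dots> \<le> c * s"
      using scaleD(2)[OF assms(1) sc[OF that(1)]] assms(2) by simp
    finally show ?thesis .
  qed
  \<comment> \<open>The end point \<open>z\<close> varies in the induction so that the hypothesis
    applies to the intersection point \<open>q\<close>.\<close>
  have "n \<le> M \<Longrightarrow> z \<in> K (w (n + 1)) \<Longrightarrow> d x z \<le> real (n + 1) * (c * s)" for n z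
  proof (induction n arbitrary: z)
    case 0
    then show ?case using step[of 1 x z] ends(1) by simp
  next
    case (Suc n)
    obtain q where q: "q \<in> K (w (n + 1))" "q \<in> K (w (Suc n + 1))"
      using link[of "n + 1"] Suc.prems(1) by auto
    have "x \<in> topspace X" "q \<in> topspace X" "z \<in> topspace X"
      using cell_subset inT[of 1] inT[of "Suc n + 1"] ends(1) q(2) Suc.prems by auto
    then have "d x z \<le> d x q + d q z" by (rule triangle)
    also have "\<dots> \<le> real (n + 1) * (c * s) + c * s"
      using Suc.IH[OF _ q(1)] step[of "Suc n + 1" q z] q(2) Suc.prems by (intro add_mono) auto
    finally show ?case by (simp add: algebra_simps)
  qed
  from this[of M y] show ?thesis using ends(2) by simp
qed

text \<open>With \<open>M + 2\<close> in place of \<open>M + 1\<close> the bound becomes (M + 1) /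
  (M + 2) times \<open>r\<close>, which gives the strict inequality of the open ball.\<close>

lemma chain_nbhd_subset_mball:
  assumes "weight_function T A \<phi> g" "0 < c"
    and "\<And>w. w \<in> T \<Longrightarrow> diam_weight K d w \<le> c * g w"
    and "x \<in> topspace X" "0 < r"
  shows "chain_nbhd T A \<phi> X K g M x (1 / (c * (M + 2)) * r) \<subseteq> mball x r"
proof
  fix y assume y: "y \<in> chain_nbhd T A \<phi> X K g M x (1 / (c * (M + 2)) * r)"
  have "d x y \<le> real (M + 1) * (c * (1 / (c * (M + 2)) * r))"
    using dist_chain_le[OF assms(1-3) y] .
  also have "\<dots> = (M + 1) / (M + 2) * r"
    using assms(2) by (simp add: divide_simps)
  also have "\<dots> < r"
    using assms(5) by (simp add: field_simps)
  finally show "y \<in> mball x r"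
    using assms(4) y by (simp add: chain_nbhd_def)
qed

section \<open>Change of weight, and comparison of diameters with an adapted weight\<close>

text \<open>Only the inclusion of balls in chain neighbourhoods is carried over from
  \<open>g\<close>; the reverse one comes from the diameter bound. In this form the lemma serves to
  pass from \<open>g\<close> to \<open>diam_weight K d\<close> and back.\<close>

lemma M_adapted_to_transfer:
  assumes "weight_function T A \<phi> g" "weight_function T A \<phi> h"
    and "M_adapted_to T A \<phi> X K M d g"
    and "0 < b" "\<And>w. w \<in> T \<Longrightarrow> h w \<le> b * g w"
    and "0 < c" "\<And>w. w \<in> T \<Longrightarrow> diam_weight K d w \<le> c * h w"
  shows "M_adapted_to T A \<phi> X K M d h"
proof -
  obtain \<alpha> where \<alpha>: "0 < \<alpha>"
    "\<And>x r. x \<in> topspace X \<Longrightarrow> 0 < r \<Longrightarrow> mball x r \<subseteq> chain_nbhd T A \<phi> X K g M x (\<alpha> * r)"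
    using assms(3) unfolding M_adapted_to_def by blast
  show ?thesis
    unfolding M_adapted_to_def
  proof (rule exI[of _ "1 / (c * (M + 2))"], rule conjI, use assms(6) in simp,
      rule exI[of _ "b * \<alpha>"], intro conjI ballI allI impI)
    show "0 < b * \<alpha>" using assms(4) \<alpha>(1) by simp
    fix x and r :: real assume xr: "x \<in> topspace X" "0 < r"
    show "chain_nbhd T A \<phi> X K h M x (1 / (c * (M + 2)) * r) \<subseteq> mball x r"
      by (rule chain_nbhd_subset_mball[OF assms(2,6,7) xr])
    show "mball x r \<subseteq> chain_nbhd T A \<phi> X K h M x (b * \<alpha> * r)"
      using \<alpha>(2)[OF xr] chain_nbhd_mono_weight[OF assms(1,2,5,4), of M x "\<alpha> * r"]
      by (simp add: mult.assoc)
  qed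
qed

text \<open>All of \<open>K w\<close> lies in a single cell of the scale \<open>g w\<close>, hence
  in the ball of radius \<open>g w / \<alpha>\<close> about any of its points.\<close>

lemma diam_weight_le_of_adapted:
  assumes "weight_function T A \<phi> g" "M_adapted_to T A \<phi> X K M d g"
  obtains c where "0 < c" "\<And>w. w \<in> T \<Longrightarrow> diam_weight K d w \<le> c * g w"
proof -
  obtain \<alpha> where \<alpha>: "0 < \<alpha>"
    "\<And>x r. x \<in> topspace X \<Longrightarrow> 0 < r \<Longrightarrow> chain_nbhd T A \<phi> X K g M x (\<alpha> * r) \<subseteq> mball x r"
    using assms(2) unfolding M_adapted_to_def by blast
  have "diam_weight K d w \<le> 1 / \<alpha> * g w" if w: "w \<in> T" for w
  proof (rule diam_weight_le[OF w])
    fix x y assume xy: "x \<in> K w" "y \<in> K w"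
    obtain u where u: "u \<in> scale T A \<phi> g (g w)" "K w \<subseteq> K u"
      using cell_in_scale[OF assms(1) w order_refl] .
    have "y \<in> chain_nbhd T A \<phi> X K g M x (\<alpha> * (1 / \<alpha> * g w))"
      using chain_nbhd_single_cell[OF u(1) scaleD(1)[OF assms(1) u(1)]] u(2) xy \<alpha>(1) by auto
    moreover have "x \<in> topspace X" "0 < 1 / \<alpha> * g w"
      using cell_subset[OF w] xy(1) \<alpha>(1) assms(1) w by (auto simp: weight_function_def)
    ultimately have "y \<in> mball x (1 / \<alpha> * g w)"
      using \<alpha>(2) by blast
    then show "d x y \<le> 1 / \<alpha> * g w" by simp
  qed
  then show ?thesis using that[of "1 / \<alpha>"] \<alpha>(1) by simp
qed

text \<open>Tightness yields two points of the cell at large chain distance; they miss each other's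
  chain neighbourhoods at smaller scales, and adaptedness turns this into a lower bound for
  \<open>d\<close>.\<close>

lemma diam_weight_ge_of_adapted_tight:
  assumes "weight_function T A \<phi> g" "M_adapted_to T A \<phi> X K M d g" "tight T A \<phi> X K g"
  obtains c where "0 < c" "\<And>w. w \<in> T \<Longrightarrow> c * g w \<le> diam_weight K d w"
proof -
  obtain \<alpha> where \<alpha>: "0 < \<alpha>"
    "\<And>x r. x \<in> topspace X \<Longrightarrow> 0 < r \<Longrightarrow> mball x r \<subseteq> chain_nbhd T A \<phi> X K g M x (\<alpha> * r)"
    using assms(2) unfolding M_adapted_to_def by blast
  obtain c where c: "0 < c"
    "\<And>w. w \<in> T \<Longrightarrow> c * g w \<le> (SUP (x, y)\<in>K w \<times> K w. chain_dist T A \<phi> X K g M x y)"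
    using assms(3) unfolding tight_def by blast
  have "c / (2 * \<alpha>) * g w \<le> diam_weight K d w" if w: "w \<in> T" for w
  proof -
    have gw: "0 < g w" using assms(1) w by (simp add: weight_function_def)
    \<comment> \<open>Halving \<open>c\<close> makes the inequality strict, so an actual pair of
      points exceeds the bound even if the supremum is not attained.\<close>
    have "c / 2 * g w < c * g w" using c(1) gw by simp
    also note c(2)[OF w]
    finally have "\<exists>p\<in>K w \<times> K w. c / 2 * g w < (\<lambda>(x, y). chain_dist T A \<phi> X K g M x y) p"
      using cell_nonempty[OF w]
      by (subst (asm) less_cSUP_iff[OF _ bdd_above_chain_dist[OF w]]) auto
    then obtain x y where xy: "x \<in> K w" "y \<in> K w"
      and far: "c / 2 * g w < chain_dist T A \<phi> X K g M x y"
      by auto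
    have inX: "x \<in> topspace X" "y \<in> topspace X"
      using xy cell_subset[OF w] by auto
    \<comment> \<open>This forces \<open>c / 2 * g w\<close> below 1, so that it is an admissible
      scale in the infimum.\<close>
    have "chain_dist T A \<phi> X K g M x y \<le> 1"
      by (rule chain_dist_le[OF _ _ chain_nbhd_one[OF inX]]) auto
    then have "y \<notin> chain_nbhd T A \<phi> X K g M x (c / 2 * g w)"
      using chain_dist_le[of "c / 2 * g w" y g M x] far c(1) gw by auto
    moreover have "\<alpha> * (c / (2 * \<alpha>) * g w) = c / 2 * g w"
      using \<alpha>(1) by simp
    ultimately have "y \<notin> mball x (c / (2 * \<alpha>) * g w)"
      using \<alpha>(2)[OF inX(1), of "c / (2 * \<alpha>) * g w"] c(1) \<alpha>(1) gw by auto
    then have "c / (2 * \<alpha>) * g w \<le> d x y" using inX by simp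
    also have "\<dots> \<le> diam_weight K d w" by (rule dist_le_diam_weight[OF w xy])
    finally show ?thesis .
  qed
  then show ?thesis using that[of "c / (2 * \<alpha>)"] c(1) \<alpha>(1) by simp
qed

text \<open>By \<open>dist_chain_le\<close>, \<open>d\<close> is at most \<open>(M + 1) * c\<close>
  times the chain distance, so a lower bound on diameters becomes one on chain distances. The
  constant depends on \<open>M\<close>, as tightness allows.\<close>

lemma tight_of_diam_weight_equivalent:
  assumes "weight_function T A \<phi> g"
    and "0 < b" "\<And>w. w \<in> T \<Longrightarrow> b * g w \<le> diam_weight K d w"
    and "0 < c" "\<And>w. w \<in> T \<Longrightarrow> diam_weight K d w \<le> c * g w"
  shows "tight T A \<phi> X K g"
  unfolding tight_def
proof
  fix M :: nat
  let ?C = "real (M + 1) * c"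
  have C: "0 < ?C" using assms(4) by simp
  have "b / ?C * g w \<le> (SUP (x, y)\<in>K w \<times> K w. chain_dist T A \<phi> X K g M x y)"
    (is "_ \<le> ?S") if w: "w \<in> T" for w
  proof -
    have "diam_weight K d w \<le> ?C * ?S"
    proof (rule diam_weight_le[OF w])
      fix x y assume xy: "x \<in> K w" "y \<in> K w"
      have "d x y / ?C \<le> chain_dist T A \<phi> X K g M x y"
      proof (rule le_chain_dist)
        show "x \<in> topspace X" "y \<in> topspace X" using xy cell_subset[OF w] by auto
        fix s assume "y \<in> chain_nbhd T A \<phi> X K g M x s"
        from dist_chain_le[OF assms(1,4,5) this] show "d x y / ?C \<le> s"
          using C by (simp add: pos_divide_le_eq mult_ac)
      qed
      also have "\<dots> \<le> ?S"
        using cSUP_upper[OF _ bdd_above_chain_dist[OF w], of "(x, y)"] xy by simp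
      finally show "d x y \<le> ?C * ?S"
        using C by (simp add: pos_divide_le_eq mult_ac)
    qed
    then have "b * g w \<le> ?C * ?S" using assms(3)[OF w] by linarith
    then show ?thesis using C by (simp add: pos_divide_le_eq mult_ac)
  qed
  then show "\<exists>a>0. \<forall>w\<in>T. a * g w \<le> (SUP (x, y)\<in>K w \<times> K w. chain_dist T A \<phi> X K g M x y)"
    using C assms(2) by (intro exI[of _ "b / ?C"]) auto
qed

end

theorem corollary8p11:
  fixes T :: "'t set" and A :: "'t \<Rightarrow> 't \<Rightarrow> nat" and \<phi> :: 't
    and X :: "'a topology" and K :: "'t \<Rightarrow> 'a set"
    and d :: "'a \<Rightarrow> 'a \<Rightarrow> real" and g :: "'t \<Rightarrow> real"
  assumes "parametrized_partition T A \<phi> X K"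
    and "d \<in> normalized_metrics X"
    and "weight_function T A \<phi> g"
  shows "adapted_to T A \<phi> X K d g \<and> tight T A \<phi> X K g \<longleftrightarrow>
         d \<in> adapted_metrics T A \<phi> X K \<and> bi_Lipschitz_equivalent T (diam_weight K d) g"
proof -
  interpret metric_partition T A \<phi> X K d
    using assms(1,2) by (simp add: metric_partition_def metric_partition_axioms_def)
  note g = assms(3)
  let ?h = "diam_weight K d"
  show ?thesis
  proof
    assume "adapted_to T A \<phi> X K d g \<and> tight T A \<phi> X K g"
    then obtain M where M: "M_adapted_to T A \<phi> X K M d g" and tight: "tight T A \<phi> X K g"
      unfolding adapted_to_def by blast
    obtain c2 where c2: "0 < c2" "\<And>w. w \<in> T \<Longrightarrow> ?h w \<le> c2 * g w"
      using diam_weight_le_of_adapted[OF g M] by blast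
    obtain c1 where c1: "0 < c1" "\<And>w. w \<in> T \<Longrightarrow> c1 * g w \<le> ?h w"
      using diam_weight_ge_of_adapted_tight[OF g M tight] by blast
    \<comment> \<open>Tightness enters here through \<open>c1\<close>: it excludes cells of diameter
      zero.\<close>
    have "0 < ?h w" if "w \<in> T" for w
    proof -
      have "0 < c1 * g w" using g that c1(1) by (simp add: weight_function_def)
      also have "\<dots> \<le> ?h w" by (rule c1(2)[OF that])
      finally show ?thesis .
    qed
    then have h: "weight_function T A \<phi> ?h"
      using weight_function_diam_weight[OF g c2(1)] c2(2) by blast
    \<comment> \<open>The target weight is the diameter itself, so its diameter bound holds with
      constant 1.\<close>
    have "M_adapted_to T A \<phi> X K M d ?h"
      by (rule M_adapted_to_transfer[OF g h M c2, where c = 1]) auto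
    then have "d \<in> adapted_metrics T A \<phi> X K"
      using h assms(2) by (auto simp: adapted_metrics_def adapted_to_def)
    then show "d \<in> adapted_metrics T A \<phi> X K \<and> bi_Lipschitz_equivalent T ?h g"
      unfolding bi_Lipschitz_equivalent_def using c1 c2 by blast
  next
    assume "d \<in> adapted_metrics T A \<phi> X K \<and> bi_Lipschitz_equivalent T ?h g"
    then obtain M c1 c2 where h: "weight_function T A \<phi> ?h" and M: "M_adapted_to T A \<phi> X K M d ?h"
      and c1: "0 < c1" "\<And>w. w \<in> T \<Longrightarrow> c1 * g w \<le> ?h w"
      and c2: "0 < c2" "\<And>w. w \<in> T \<Longrightarrow> ?h w \<le> c2 * g w"
      unfolding adapted_metrics_def adapted_to_def bi_Lipschitz_equivalent_def by blast
    have "g w \<le> 1 / c1 * ?h w" if "w \<in> T" for w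
      using c1(2)[OF that] c1(1) by (simp add: field_simps)
    \<comment> \<open>The roles are exchanged: \<open>1 / c1\<close> rescales the chains, and
      \<open>c2\<close> bounds diameters by the target weight \<open>g\<close>.\<close>
    then have "M_adapted_to T A \<phi> X K M d g"
      using M_adapted_to_transfer[OF h g M, of "1 / c1" c2] c1(1) c2 by simp
    then show "adapted_to T A \<phi> X K d g \<and> tight T A \<phi> X K g"
      unfolding adapted_to_def using tight_of_diam_weight_equivalent[OF g c1 c2] by blast
  qed
qed

end
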